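(* For a finite semigroup $S$, the following are equivalent: (i) The power graph $\mathrm{Pow}(S)$ is complete. (ii) For some prime $p$ and $n\in\mathbb{N}_0$, we have $S=M(m,p^n)$ with either $m\in\{1,2\}$, or $m=3$ and $3+p^n$ even. (iii) The cyclic subsemigroups of $S$ are linearly ordered with respect to the usual containment relation, i.e., for any two cyclic subsemigroups $S_1,S_2$ of $S$, $S_1\subseteq S_2$ or $S_2\subseteq S_1$.
   Context: Semigroups are nonempty. $\mathbb{N}$ is the set of positive integers and $\mathbb{N}_0=\mathbb{N}\cup\{0\}$. For $a\in S$, $\langle a\rangle=\{a^k:k\in\mathbb{N}\}$; a cyclic (monogenic) subsemigroup is one of the form $\langle a\rangle$. For an element $a$ of a finite semigroup, the index $m$ of $a$ is the least $x\in\mathbb{N}$ such that $a^x=a^y$ for some $y\in\mathbb{N}$, $y\neq x$, and the period $r$ of $a$ is the least $x\in\mathbb{N}$ with $a^{m+x}=a^m$. Writing $S=M(m,r)$ means that $S=\langle a\rangle$ for some $a\in S$ with index $m$ and period $r$. The power graph $\mathrm{Pow}(S)$ is the simple graph with vertex set $S$ in which two distinct elements $x,y$ are adjacent if and only if $x=y^k$ or $y=x^k$ for some $k\in\mathbb{N}$. A graph is complete if any two distinct vertices are adjacent. *)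

theory Defs
  imports "HOL-Computational_Algebra.Primes" "Graph_Theory.Kuratowski"
begin

text \<open>A semigroup is modelled as a nonempty multiplicatively closed set \<open>S\<close> of elements of a type
  of class \<^class>\<open>semigroup_mult\<close>. Nothing is lost: any semigroup on a carrier set extends to a
  whole type after adjoining a zero.\<close>

definition subsemigroup :: "'a::semigroup_mult set \<Rightarrow> bool" where
  "subsemigroup S \<longleftrightarrow> S \<noteq> {} \<and> (\<forall>x\<in>S. \<forall>y\<in>S. x * y \<in> S)"

text \<open>Class \<^class>\<open>semigroup_mult\<close> has no unit, so the library power is not available.
  \<open>spow a k\<close> is $a^k$ for $k \ge 1$; the value at $k = 0$ is meaningless, and every use below is
  restricted to positive exponents.\<close>

definition spow :: "'a::semigroup_mult \<Rightarrow> nat \<Rightarrow> 'a" where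
  "spow a k = (((*) a) ^^ (k - 1)) a"

lemma spow_1 [simp]: "spow a 1 = a" "spow a (Suc 0) = a"
  by (simp_all add: spow_def)

lemma spow_Suc: "k \<ge> 1 \<Longrightarrow> spow a (Suc k) = a * spow a k"
  by (cases k) (simp_all add: spow_def)

definition cyclic_gen :: "'a::semigroup_mult \<Rightarrow> 'a set" where
  "cyclic_gen a = {spow a k | k. k \<ge> 1}"

definition cyclic_subsemigroup :: "'a::semigroup_mult set \<Rightarrow> 'a set \<Rightarrow> bool" where
  "cyclic_subsemigroup T S \<longleftrightarrow> (\<exists>a\<in>S. T = cyclic_gen a)"

text \<open>The numbers sought in the next two definitions exist whenever \<open>cyclic_gen a\<close> is finite.\<close>

definition elem_index :: "'a::semigroup_mult \<Rightarrow> nat" where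
  "elem_index a = (LEAST x. x \<ge> 1 \<and> (\<exists>y\<ge>1. y \<noteq> x \<and> spow a x = spow a y))"

definition elem_period :: "'a::semigroup_mult \<Rightarrow> nat" where
  "elem_period a = (LEAST x. x \<ge> 1 \<and> spow a (elem_index a + x) = spow a (elem_index a))"

text \<open>\<open>is_M S m r\<close> is $S = M(m,r)$, for finite \<open>S\<close>.\<close>

definition is_M :: "'a::semigroup_mult set \<Rightarrow> nat \<Rightarrow> nat \<Rightarrow> bool" where
  "is_M S m r \<longleftrightarrow> (\<exists>a\<in>S. S = cyclic_gen a \<and> elem_index a = m \<and> elem_period a = r)"

text \<open>As usual in this graph library, a simple graph is a symmetric loop-free digraph without
  multiple arcs.\<close>

definition power_graph :: "'a::semigroup_mult set \<Rightarrow> 'a pair_pre_digraph" where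
  "power_graph S = \<lparr> pverts = S,
     parcs = {(x, y). x \<in> S \<and> y \<in> S \<and> x \<noteq> y \<and> (\<exists>k\<ge>1. x = spow y k \<or> y = spow x k)} \<rparr>"

lemma pair_graph_power_graph:
  assumes "finite S"
  shows "pair_graph (power_graph S)"
proof -
  have "parcs (power_graph S) \<subseteq> S \<times> S"
    by (auto simp: power_graph_def)
  then have "finite (parcs (power_graph S))"
    by (rule finite_subset) (simp add: assms)
  moreover have "sym (parcs (power_graph S))"
    by (rule symI) (auto simp: power_graph_def)
  ultimately show ?thesis
    using assms by unfold_locales (auto simp: power_graph_def symmetric_def)
qed

definition complete_graph :: "('a, 'b) pre_digraph \<Rightarrow> bool" where
  "complete_graph G \<longleftrightarrow> K\<^bsub>card (verts G)\<^esub> G"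

lemma complete_graph_iff:
  assumes "graph G"
  shows "complete_graph G \<longleftrightarrow> (\<forall>x\<in>verts G. \<forall>y\<in>verts G. x \<noteq> y \<longrightarrow> x \<rightarrow>\<^bsub>G\<^esub> y)"
proof -
  interpret graph G by (rule assms)
  show ?thesis
    using assms adj_not_same
    by (fastforce simp: complete_graph_def complete_digraph_def)
qed

end

theory Submission
  imports Defs "HOL-Number_Theory.Cong"
begin

text \<open>
  Completeness of the power graph says that of any two elements one is a power of the other. Since
  \<open>x\<close> is a power of \<open>y\<close> exactly when \<open>\<langle>x\<rangle> \<subseteq> \<langle>y\<rangle>\<close>, this is the same as comparability of the
  cyclic subsemigroups. In a finite semigroup with comparable cyclic subsemigroups a largest one
  contains every element, so \<open>S = \<langle>a\<rangle>\<close> for some \<open>a\<close>, and only monogenic semigroups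
  \<open>M(m, r)\<close> remain to be examined.

  There everything is arithmetic of exponents (\<open>spow_eq_iff\<close>): \<open>a\<^sup>i = a\<^sup>j\<close> iff \<open>i = j\<close>, or
  both exponents are at least \<open>m\<close> and agree modulo \<open>r\<close>.

  Completeness of the power graph therefore restricts both parameters:
  \<^item> \<open>r\<close> cannot have two distinct prime divisors \<open>p\<close> and \<open>q\<close>. Two powers of \<open>a\<close> with exponents
    at least \<open>m\<close>, one congruent to \<open>p\<close> and one to \<open>q\<close> modulo \<open>r\<close>, would be incomparable:
    since \<open>q\<close> divides \<open>r\<close>, all powers of the second have exponents divisible by \<open>q\<close>, and the
    exponent of the first is not; the roles of \<open>p\<close> and \<open>q\<close> are symmetric.
  \<^item> \<open>m \<le> 3\<close>, and \<open>r\<close> is odd if \<open>m = 3\<close>, as one sees by comparing \<open>a\<^sup>2\<close> with \<open>a\<^sup>3\<close>.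

  Conversely, let \<open>r = p\<^sup>n\<close>. For \<open>j \<ge> m\<close>, the element \<open>a\<^sup>j\<close> is a power of \<open>a\<^sup>i\<close> as soon as
  \<open>gcd i r\<close> divides \<open>j\<close> (\<open>spow_multiple_of_gcd_dvd\<close>). Divisors of a prime power form a chain, so any
  two powers with exponents at least \<open>m\<close> are comparable. The only smaller exponents are \<open>1\<close>, where
  \<open>a\<close> generates everything, and \<open>2\<close> in the case \<open>m = 3\<close>, where \<open>2\<close> is invertible modulo \<open>r\<close>.
\<close>

section \<open>Powers in a semigroup\<close>

lemma spow_add:
  assumes "i \<ge> 1" "j \<ge> 1"
  shows "spow a (i + j) = spow a i * spow a j"
  using assms(1)
proof (induction i rule: dec_induct)
  case base
  show ?case using assms(2) by (simp add: spow_Suc)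
next
  case (step i)
  then show ?case by (simp add: spow_Suc mult.assoc)
qed

lemma spow_spow:
  assumes "i \<ge> 1" "j \<ge> 1"
  shows "spow (spow a i) j = spow a (i * j)"
  using assms(2)
proof (induction j rule: dec_induct)
  case base
  show ?case by simp
next
  case (step j)
  then show ?case using assms(1) by (simp add: spow_Suc spow_add)
qed

lemma cyclic_gen_subset_iff: "cyclic_gen x \<subseteq> cyclic_gen y \<longleftrightarrow> (\<exists>k\<ge>1. x = spow y k)"
proof
  assume "cyclic_gen x \<subseteq> cyclic_gen y"
  moreover have "x \<in> cyclic_gen x"
    using spow_1(1)[of x] unfolding cyclic_gen_def by (metis (mono_tags) le_refl mem_Collect_eq)
  ultimately show "\<exists>k\<ge>1. x = spow y k" by (auto simp: cyclic_gen_def)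
next
  assume "\<exists>k\<ge>1. x = spow y k"
  then obtain k where k: "k \<ge> 1" "x = spow y k" by blast
  have "spow x l \<in> cyclic_gen y" if "l \<ge> 1" for l
  proof -
    have "spow x l = spow y (k * l)" "k * l \<ge> 1" using that k by (simp_all add: spow_spow)
    then show ?thesis by (auto simp: cyclic_gen_def)
  qed
  then show "cyclic_gen x \<subseteq> cyclic_gen y" by (auto simp: cyclic_gen_def)
qed

lemma cyclic_gen_subset_subsemigroup:
  assumes "subsemigroup S" "a \<in> S"
  shows "cyclic_gen a \<subseteq> S"
proof -
  have "spow a k \<in> S" if "k \<ge> 1" for k
    using that
  proof (induction k rule: dec_induct)
    case base
    show ?case using assms(2) by simp
  next
    case (step k)
    then show ?case using assms by (simp add: spow_Suc subsemigroup_def)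
  qed
  then show ?thesis by (auto simp: cyclic_gen_def)
qed

section \<open>Index and period\<close>

context
  fixes a :: "'a::semigroup_mult"
  assumes fin: "finite (cyclic_gen a)"
begin

lemma elem_index_props:
  shows "elem_index a \<ge> 1" and "\<exists>y\<ge>1. y \<noteq> elem_index a \<and> spow a (elem_index a) = spow a y"
proof -
  have "\<not> inj_on (spow a) {1..}"
  proof
    assume "inj_on (spow a) {1..}"
    moreover have "finite (spow a ` {1..})"
      by (rule finite_subset[OF _ fin]) (auto simp: cyclic_gen_def)
    ultimately show False
      using finite_imageD infinite_Ici by blast
  qed
  then have "\<exists>x. x \<ge> 1 \<and> (\<exists>y\<ge>1. y \<noteq> x \<and> spow a x = spow a y)"
    unfolding inj_on_def by fastforce
  from LeastI_ex[OF this]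
  show "elem_index a \<ge> 1" "\<exists>y\<ge>1. y \<noteq> elem_index a \<and> spow a (elem_index a) = spow a y"
    unfolding elem_index_def by blast+
qed

lemma elem_index_le:
  assumes "i \<ge> 1" "j \<ge> 1" "i \<noteq> j" "spow a i = spow a j"
  shows "elem_index a \<le> i"
  unfolding elem_index_def using assms by (intro Least_le) blast

lemma elem_period_props:
  shows "elem_period a \<ge> 1" and "spow a (elem_index a + elem_period a) = spow a (elem_index a)"
proof -
  obtain y where y: "y \<ge> 1" "y \<noteq> elem_index a" "spow a (elem_index a) = spow a y"
    using elem_index_props(2) by blast
  have "y > elem_index a"
    using elem_index_le[of y "elem_index a"] elem_index_props(1) y by force
  then have "\<exists>x. x \<ge> 1 \<and> spow a (elem_index a + x) = spow a (elem_index a)"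
    using y(3) by (intro exI[of _ "y - elem_index a"]) auto
  from LeastI_ex[OF this]
  show "elem_period a \<ge> 1" "spow a (elem_index a + elem_period a) = spow a (elem_index a)"
    unfolding elem_period_def by blast+
qed

lemma spow_add_period_multiple:
  assumes "i \<ge> elem_index a"
  shows "spow a (i + elem_period a * t) = spow a i"
proof -
  have one: "spow a (i + elem_period a) = spow a i" if "i \<ge> elem_index a" for i
  proof (cases "i = elem_index a")
    case True
    then show ?thesis by (simp add: elem_period_props(2))
  next
    case False
    define d where "d = i - elem_index a"
    have d: "d \<ge> 1" "i = elem_index a + d" using False that by (auto simp: d_def)
    have "spow a (i + elem_period a) = spow a ((elem_index a + elem_period a) + d)"
      by (simp add: d(2) ac_simps)
    also have "\<dots> = spow a (elem_index a + elem_period a) * spow a d"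
      using d elem_index_props(1) by (intro spow_add) auto
    also have "\<dots> = spow a i"
      using d elem_index_props(1) by (simp add: elem_period_props(2) spow_add)
    finally show ?thesis .
  qed
  show ?thesis
  proof (induction t)
    case (Suc t)
    have "spow a (i + elem_period a * Suc t) = spow a ((i + elem_period a * t) + elem_period a)"
      by (simp add: ac_simps)
    also have "\<dots> = spow a (i + elem_period a * t)"
      using assms by (intro one) auto
    finally show ?case using Suc by simp
  qed simp
qed

lemma spow_eq_of_cong:
  assumes "i \<ge> elem_index a" "j \<ge> elem_index a" "[i = j] (mod elem_period a)"
  shows "spow a i = spow a j"
  using assms
proof (induction i j rule: linorder_wlog)
  case (le i j)
  then obtain t where "j = i + elem_period a * t"
    using cong_le_nat by (metis cong_sym_eq add.commute mult.commute)
  then show ?case using le spow_add_period_multiple by simp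
next
  case (sym i j)
  then show ?case by (metis cong_sym_eq)
qed

text \<open>Minimality of the period only concerns powers based at the index \<open>m\<close>. A coincidence
  \<open>a\<^sup>i = a\<^sup>j\<close> is moved there by multiplying with a power of \<open>a\<close> that makes the exponent \<open>i\<close>
  congruent to \<open>m\<close>; the residue of \<open>j - i\<close> modulo the period must then vanish.\<close>

lemma cong_of_spow_eq:
  assumes "i \<ge> 1" "i \<le> j" "spow a i = spow a j"
  shows "[i = j] (mod elem_period a)"
proof -
  define m where "m = elem_index a"
  define r where "r = elem_period a"
  define d where "d = j - i"
  define N where "N = m + (r - 1) * i"
  have j: "j = i + d" using assms by (simp add: d_def)
  have m: "m \<ge> 1" and r: "r \<ge> 1"
    using elem_index_props(1) elem_period_props(1) by (simp_all add: m_def r_def)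
  have N: "N \<ge> 1" "i + N = m + r * i"
    using m r by (cases r; simp add: N_def)+
  have "spow a m = spow a (m + r * i)"
    using spow_add_period_multiple[of m i] by (simp add: m_def r_def)
  also have "\<dots> = spow a i * spow a N"
    using spow_add[of i N a] assms(1) N by simp
  also have "\<dots> = spow a (j + N)"
    using spow_add[of j N a] assms N(1) by simp
  also have "j + N = (m + d) + r * i" using N(2) j by linarith
  also have "spow a \<dots> = spow a (m + d)"
    unfolding r_def by (rule spow_add_period_multiple) (simp add: m_def)
  also have "m + d = (m + d mod r) + r * (d div r)" by simp
  also have "spow a \<dots> = spow a (m + d mod r)"
    unfolding r_def by (rule spow_add_period_multiple) (simp add: m_def)
  finally have *: "spow a (m + d mod r) = spow a m" by simp
  have "d mod r = 0"
  proof (rule ccontr)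
    assume "d mod r \<noteq> 0"
    then have "elem_period a \<le> d mod r"
      unfolding elem_period_def using * by (intro Least_le) (auto simp: m_def)
    moreover have "d mod r < r" using r by simp
    ultimately show False by (simp add: r_def)
  qed
  then show ?thesis by (auto simp: j cong_def r_def elim!: dvdE simp flip: mod_add_right_eq)
qed

lemma spow_eq_iff:
  assumes "i \<ge> 1" "j \<ge> 1"
  shows "spow a i = spow a j \<longleftrightarrow>
    i = j \<or> i \<ge> elem_index a \<and> j \<ge> elem_index a \<and> [i = j] (mod elem_period a)"
proof
  assume eq: "spow a i = spow a j"
  have "[i = j] (mod elem_period a)"
    using assms eq cong_of_spow_eq[of i j] cong_of_spow_eq[of j i] by (metis cong_sym_eq nle_le)
  then show "i = j \<or> i \<ge> elem_index a \<and> j \<ge> elem_index a \<and> [i = j] (mod elem_period a)"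
    using elem_index_le assms eq by metis
qed (use spow_eq_of_cong in blast)

section \<open>Comparable powers of a generator\<close>

lemma spow_multiple_of_gcd_dvd:
  assumes "i \<ge> 1" "j \<ge> 1" "j \<ge> elem_index a" "gcd i (elem_period a) dvd j"
  shows "\<exists>k\<ge>1. spow a j = spow a (i * k)"
proof -
  define r where "r = elem_period a"
  have r: "r \<ge> 1" using elem_period_props(1) by (simp add: r_def)
  obtain x where x: "[i * x = j] (mod r)"
    using cong_solve_dvd_nat[of i r j] assms by (auto simp: r_def)
  \<comment> \<open>A summand divisible by the period lifts the exponent above the index.\<close>
  define k where "k = x + r * j"
  have "j \<le> r * j" "r * j \<le> k" using r by (simp_all add: k_def)
  then have jk: "j \<le> k" by linarith
  have k: "k \<ge> 1" using jk assms(2) by linarith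
  have ik: "i * k \<ge> j" using jk assms(1) by (metis le_trans mult_le_mono1 nat_mult_1)
  have "i * k = i * x + r * (i * j)" by (simp add: k_def algebra_simps)
  then have "[i * k = j] (mod r)" using x by (simp add: cong_def)
  then have "spow a (i * k) = spow a j"
    using ik assms(3) by (intro spow_eq_of_cong) (auto simp: r_def)
  then show ?thesis using k by metis
qed

lemma powers_comparable_if_prime_power_period:
  assumes "prime p" "elem_period a = p ^ n"
    and "elem_index a \<in> {1, 2} \<or> elem_index a = 3 \<and> odd (p ^ n)"
    and "i \<ge> 1" "j \<ge> 1"
  shows "\<exists>k\<ge>1. spow a i = spow a (j * k) \<or> spow a j = spow a (i * k)"
proof -
  have small: "\<exists>k\<ge>1. spow a j = spow a (i * k)"
    if "i \<ge> 1" "j \<ge> 1" "i < elem_index a" "i \<le> j" for i j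
  proof (cases "i = 1 \<or> i = j")
    case True
    then show ?thesis
    proof
      assume "i = 1"
      then show ?thesis using that by (intro exI[of _ j]) simp
    next
      assume "i = j"
      then show ?thesis by (intro exI[of _ 1]) simp
    qed
  next
    case False
    then have *: "i = 2" "elem_index a = 3" "odd (p ^ n)" "j \<ge> 3" using that assms(3) by auto
    then have "gcd i (elem_period a) = 1"
      by (simp add: assms(2) flip: coprime_iff_gcd_eq_1)
    then show ?thesis using that(1,2) * by (intro spow_multiple_of_gcd_dvd) simp_all
  qed
  show ?thesis
  proof (cases "i < elem_index a \<or> j < elem_index a")
    case True
    then show ?thesis
      using small[of i j] small[of j i] assms(4,5) by (metis le_less_trans nle_le)
  next
    case False
    obtain s where s: "gcd i (p ^ n) = p ^ s"
      using divides_primepow_nat[OF assms(1), of "gcd i (p ^ n)" n] by auto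
    obtain t where t: "gcd j (p ^ n) = p ^ t"
      using divides_primepow_nat[OF assms(1), of "gcd j (p ^ n)" n] by auto
    have "gcd i (p ^ n) dvd gcd j (p ^ n) \<or> gcd j (p ^ n) dvd gcd i (p ^ n)"
      unfolding s t by (metis le_imp_power_dvd nle_le)
    then have "gcd i (p ^ n) dvd j \<or> gcd j (p ^ n) dvd i"
      by (metis dvd_trans gcd_dvd1)
    then show ?thesis
      using spow_multiple_of_gcd_dvd[of i j] spow_multiple_of_gcd_dvd[of j i] assms(2,4,5) False
      by (metis linorder_not_le)
  qed
qed

context
  assumes comparable:
    "\<And>i j. i \<ge> 1 \<Longrightarrow> j \<ge> 1 \<Longrightarrow> \<exists>k\<ge>1. spow a i = spow a (j * k) \<or> spow a j = spow a (i * k)"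
begin

lemma prime_dvd_period_unique:
  assumes "prime p" "prime q" "p dvd elem_period a" "q dvd elem_period a"
  shows "p = q"
proof -
  define m where "m = elem_index a"
  define r where "r = elem_period a"
  have r: "r \<ge> 1" using elem_period_props(1) by (simp add: r_def)
  \<comment> \<open>The multiple of \<open>r\<close> lifts the exponents \<open>p\<close> and \<open>q\<close> to at least the index, into the range
    where equality of powers is congruence.\<close>
  have incomparable: "q dvd p"
    if "k \<ge> 1" "spow a (p + m * r) = spow a ((q + m * r) * k)" "prime p" "prime q" "q dvd r"
    for k p q
  proof -
    have "p + m * r \<ge> 1" "(q + m * r) * k \<ge> 1"
      using that prime_gt_0_nat by (auto simp: Suc_le_eq)
    then have "[p + m * r = (q + m * r) * k] (mod r)"
      using that(2) by (auto simp: spow_eq_iff r_def)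
    then have "[p + m * r = (q + m * r) * k] (mod q)"
      using that(5) by (rule cong_dvd_modulus_nat)
    moreover have "q dvd (q + m * r) * k" using that(5) by simp
    ultimately have "q dvd p + m * r" by (simp add: cong_dvd_iff)
    then show ?thesis using that(5) by (simp add: dvd_add_left_iff)
  qed
  have "p + m * r \<ge> 1" "q + m * r \<ge> 1" using assms prime_ge_1_nat by (simp_all add: trans_le_add1)
  then obtain k where "k \<ge> 1"
    "spow a (p + m * r) = spow a ((q + m * r) * k) \<or> spow a (q + m * r) = spow a ((p + m * r) * k)"
    using comparable by blast
  then have "q dvd p \<or> p dvd q"
    using incomparable assms by (auto simp: r_def)
  then show ?thesis using assms by (metis primes_dvd_imp_eq)
qed

lemma period_prime_power: "\<exists>p n. prime p \<and> elem_period a = p ^ n"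
proof (cases "elem_period a = 1")
  case True
  then show ?thesis by (intro exI[of _ 2] exI[of _ 0]) auto
next
  case False
  then obtain p where p: "prime p" "p dvd elem_period a"
    using prime_factor_nat by blast
  have "elem_period a \<noteq> 0" using elem_period_props(1) by simp
  then obtain n s where s: "elem_period a = p ^ n * s" "\<not> p dvd s"
    using multiplicity_decompose'[of "elem_period a" p] p(1) by (metis not_prime_unit)
  have "s = 1"
  proof (rule ccontr)
    assume "s \<noteq> 1"
    then obtain q where "prime q" "q dvd s" using prime_factor_nat by blast
    then show False using prime_dvd_period_unique[of p q] p s by auto
  qed
  then show ?thesis using p s by auto
qed

text \<open>If the index exceeds \<open>2\<close>, then \<open>a\<^sup>2\<close> differs from all other powers of \<open>a\<close>, so it is not a
  power of \<open>a\<^sup>3\<close>; hence \<open>a\<^sup>3\<close> has to be an even power of \<open>a\<close>.\<close>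

lemma index_restriction:
  "elem_index a \<in> {1, 2} \<or> elem_index a = 3 \<and> odd (elem_period a)"
proof (cases "elem_index a \<le> 2")
  case True
  then show ?thesis using elem_index_props(1) by auto
next
  case False
  obtain k where k: "k \<ge> 1" "spow a 2 = spow a (3 * k) \<or> spow a 3 = spow a (2 * k)"
    using comparable[of 2 3] by auto
  have "spow a 2 \<noteq> spow a (3 * k)"
    using False k(1) by (subst spow_eq_iff) auto
  then have "3 = 2 * k \<or> 3 \<ge> elem_index a \<and> [3 = 2 * k] (mod elem_period a)"
    using k by (subst (asm) (2) spow_eq_iff) auto
  moreover have "3 \<noteq> 2 * k" by presburger
  ultimately have *: "elem_index a = 3" "[3 = 2 * k] (mod elem_period a)"
    using False by auto
  have "odd (elem_period a)"
  proof
    assume "even (elem_period a)"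
    then have "[3 = 2 * k] (mod 2)" using *(2) by (metis cong_dvd_modulus_nat)
    then show False by (simp add: cong_def)
  qed
  then show ?thesis using * by simp
qed

end

end

section \<open>The power graph\<close>

lemma complete_power_graph_iff:
  assumes "finite S"
  shows "complete_graph (with_proj (power_graph S)) \<longleftrightarrow>
    (\<forall>x\<in>S. \<forall>y\<in>S. \<exists>k\<ge>1. x = spow y k \<or> y = spow x k)"
proof -
  interpret pair_graph "power_graph S" by (rule pair_graph_power_graph[OF assms])
  have "graph (with_proj (power_graph S))" by unfold_locales
  then have "complete_graph (with_proj (power_graph S)) \<longleftrightarrow>
    (\<forall>x\<in>S. \<forall>y\<in>S. x \<noteq> y \<longrightarrow> (\<exists>k\<ge>1. x = spow y k \<or> y = spow x k))"
    by (subst complete_graph_iff) (auto simp: power_graph_def arcs_ends_def arc_to_ends_def)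
  also have "\<dots> \<longleftrightarrow> (\<forall>x\<in>S. \<forall>y\<in>S. \<exists>k\<ge>1. x = spow y k \<or> y = spow x k)"
    by (metis le_refl spow_1(1))
  finally show ?thesis .
qed

lemma complete_power_graph_iff_chain:
  assumes "finite S"
  shows "complete_graph (with_proj (power_graph S)) \<longleftrightarrow>
    (\<forall>S1 S2. cyclic_subsemigroup S1 S \<and> cyclic_subsemigroup S2 S \<longrightarrow> S1 \<subseteq> S2 \<or> S2 \<subseteq> S1)"
proof -
  have "complete_graph (with_proj (power_graph S)) \<longleftrightarrow>
    (\<forall>x\<in>S. \<forall>y\<in>S. cyclic_gen x \<subseteq> cyclic_gen y \<or> cyclic_gen y \<subseteq> cyclic_gen x)"
    unfolding complete_power_graph_iff[OF assms] cyclic_gen_subset_iff by metis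
  then show ?thesis unfolding cyclic_subsemigroup_def by blast
qed

text \<open>A cyclic subsemigroup of maximal size contains all others when they form a chain.\<close>

lemma monogenic_if_complete:
  assumes "subsemigroup S" "finite S" "complete_graph (with_proj (power_graph S))"
  shows "\<exists>a\<in>S. S = cyclic_gen a"
proof -
  have "S \<noteq> {}" using assms(1) by (simp add: subsemigroup_def)
  then obtain a where a: "a \<in> S" "\<And>x. x \<in> S \<Longrightarrow> card (cyclic_gen x) \<le> card (cyclic_gen a)"
    using Max_in[of "(\<lambda>x. card (cyclic_gen x)) ` S"] Max_ge[of "(\<lambda>x. card (cyclic_gen x)) ` S"]
      assms(2) by (smt (verit) finite_imageI imageE image_eqI image_is_empty)
  have "x \<in> cyclic_gen a" if "x \<in> S" for x
  proof -
    have "cyclic_gen x \<subseteq> cyclic_gen a \<or> cyclic_gen a \<subseteq> cyclic_gen x"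
      using assms(3) that a(1) unfolding complete_power_graph_iff_chain[OF assms(2)]
      by (auto simp: cyclic_subsemigroup_def)
    moreover have "finite (cyclic_gen x)"
      using cyclic_gen_subset_subsemigroup[OF assms(1) that] assms(2) finite_subset by blast
    ultimately have "cyclic_gen x \<subseteq> cyclic_gen a"
      using a(2)[OF that] by (metis card_seteq subset_refl)
    then show ?thesis unfolding cyclic_gen_subset_iff by (auto simp: cyclic_gen_def)
  qed
  then show ?thesis using a(1) cyclic_gen_subset_subsemigroup[OF assms(1) a(1)] by blast
qed

lemma complete_power_graph_monogenic_iff:
  assumes "finite (cyclic_gen a)"
  shows "complete_graph (with_proj (power_graph (cyclic_gen a))) \<longleftrightarrow>
    (\<exists>p n. prime p \<and> elem_period a = p ^ n) \<and>
    (elem_index a \<in> {1, 2} \<or> elem_index a = 3 \<and> odd (elem_period a))"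
proof -
  have "complete_graph (with_proj (power_graph (cyclic_gen a))) \<longleftrightarrow>
    (\<forall>i\<ge>1. \<forall>j\<ge>1. \<exists>k\<ge>1. spow a i = spow (spow a j) k \<or> spow a j = spow (spow a i) k)"
    unfolding complete_power_graph_iff[OF assms] by (auto simp: cyclic_gen_def)
  also have "\<dots> \<longleftrightarrow>
    (\<forall>i\<ge>1. \<forall>j\<ge>1. \<exists>k\<ge>1. spow a i = spow a (j * k) \<or> spow a j = spow a (i * k))"
    by (metis spow_spow)
  also have "\<dots> \<longleftrightarrow> (\<exists>p n. prime p \<and> elem_period a = p ^ n) \<and>
    (elem_index a \<in> {1, 2} \<or> elem_index a = 3 \<and> odd (elem_period a))" (is "?L \<longleftrightarrow> ?R")
  proof
    assume ?L
    then show ?R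
      using period_prime_power[OF assms] index_restriction[OF assms] by blast
  next
    assume ?R
    then obtain p n where p: "prime p" "elem_period a = p ^ n"
      and m: "elem_index a \<in> {1, 2} \<or> elem_index a = 3 \<and> odd (p ^ n)" by metis
    show ?L using powers_comparable_if_prime_power_period[OF assms p m] by blast
  qed
  finally show ?thesis .
qed

theorem theorem3p5:
  fixes S :: "'a::semigroup_mult set"
  assumes "subsemigroup S" and "finite S"
  shows "(complete_graph (with_proj (power_graph S)) \<longleftrightarrow>
          (\<exists>p n m :: nat. prime p \<and> is_M S m (p ^ n) \<and>
             (m \<in> {1, 2} \<or> m = 3 \<and> even (3 + p ^ n)))) \<and>
         (complete_graph (with_proj (power_graph S)) \<longleftrightarrow>
          (\<forall>S1 S2. cyclic_subsemigroup S1 S \<and> cyclic_subsemigroup S2 S \<longrightarrow>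
             S1 \<subseteq> S2 \<or> S2 \<subseteq> S1))"
proof (intro conjI complete_power_graph_iff_chain[OF assms(2)] iffI)
  assume complete: "complete_graph (with_proj (power_graph S))"
  then obtain a where a: "a \<in> S" "S = cyclic_gen a"
    using monogenic_if_complete[OF assms] by blast
  then obtain p n where p: "prime p" "elem_period a = p ^ n"
    and m: "elem_index a \<in> {1, 2} \<or> elem_index a = 3 \<and> odd (elem_period a)"
    using complete complete_power_graph_monogenic_iff[of a] assms(2) by blast
  have "is_M S (elem_index a) (p ^ n)" using a p by (auto simp: is_M_def)
  moreover have "elem_index a \<in> {1, 2} \<or> elem_index a = 3 \<and> even (3 + p ^ n)"
    using m unfolding p(2) by auto
  ultimately show "\<exists>p n m :: nat. prime p \<and> is_M S m (p ^ n) \<and>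
      (m \<in> {1, 2} \<or> m = 3 \<and> even (3 + p ^ n))"
    using p(1) by blast
next
  assume "\<exists>p n m :: nat. prime p \<and> is_M S m (p ^ n) \<and>
      (m \<in> {1, 2} \<or> m = 3 \<and> even (3 + p ^ n))"
  then obtain p n a where p: "prime p" "elem_period a = p ^ n" and S: "S = cyclic_gen a"
    and "elem_index a \<in> {1, 2} \<or> elem_index a = 3 \<and> even (3 + p ^ n)"
    unfolding is_M_def by blast
  then have "elem_index a \<in> {1, 2} \<or> elem_index a = 3 \<and> odd (elem_period a)"
    unfolding p(2) by auto
  then show "complete_graph (with_proj (power_graph S))"
    using complete_power_graph_monogenic_iff[of a] assms(2) p unfolding S by blast
qed

end
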